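(* Let $\mathfrak{h}$ be the three-dimensional real Lie algebra with basis $h^1,h^2,h^3$ (the hybrid units), let $K$ be the matrix $\big(K(h^i,h^j)\big)_{i,j=1}^3$ of its Killing form $K(X,Y)=\operatorname{tr}(\mathrm{ad}_X\circ\mathrm{ad}_Y)$, and let $B=\frac12K$. Then $$\det(B-\lambda I)=(1-\lambda)(\lambda^2+\lambda-1),$$ and the eigenvalues of $B$ are $$\lambda_1=1,\qquad \lambda_2=\frac{-1+\sqrt5}{2}=\frac1\varphi,\qquad \lambda_3=\frac{-1-\sqrt5}{2}=-\varphi,$$ where $\varphi=\frac{1+\sqrt5}{2}$ is the golden ratio.
   Context: Superscripts on $h^1,h^2,h^3$ are indices, not powers. The Lie bracket on $\mathfrak{h}=\mathrm{span}_{\mathbb{R}}\{h^1,h^2,h^3\}$ is the antisymmetric bilinear bracket with $$[h^1,h^2]=-h^3,\qquad [h^1,h^3]=h^1+h^2,\qquad [h^2,h^3]=-h^2 ,$$ which is one half of the commutator $XY-YX$ of hybrid numbers. $\mathrm{ad}_X(Y)=[X,Y]$. *)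

theory Defs
  imports "HOL-Analysis.Analysis"
begin

definition ad :: "('a \<Rightarrow> 'a \<Rightarrow> 'a) \<Rightarrow> 'a \<Rightarrow> 'a \<Rightarrow> 'a"
  where "ad br X = (\<lambda>Y. br X Y)"

definition killing_form :: "(real^'n \<Rightarrow> real^'n \<Rightarrow> real^'n) \<Rightarrow> real^'n \<Rightarrow> real^'n \<Rightarrow> real"
  where "killing_form br X Y = trace (matrix (ad br X \<circ> ad br Y))"

definition eigenvalue :: "real^'n^'n \<Rightarrow> real \<Rightarrow> bool"
  where "eigenvalue A l \<longleftrightarrow> (\<exists>v. v \<noteq> 0 \<and> A *v v = l *\<^sub>R v)"

text \<open>The space spanned by the hybrid units is identified with \<^typ>\<open>real^3\<close> by taking
  coordinates with respect to them.\<close>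

definition hu :: "3 \<Rightarrow> real^3"
  where "hu i = axis i 1"

text \<open>The bilinear, antisymmetric extension of the bracket relations stated in the lemma
  \<open>hbracket_units\<close> below.\<close>

definition hbracket :: "real^3 \<Rightarrow> real^3 \<Rightarrow> real^3"
  where "hbracket X Y =
    (X$1 * Y$2 - X$2 * Y$1) *\<^sub>R (- hu 3)
  + (X$1 * Y$3 - X$3 * Y$1) *\<^sub>R (hu 1 + hu 2)
  + (X$2 * Y$3 - X$3 * Y$2) *\<^sub>R (- hu 2)"

lemma hbracket_units:
  "hbracket (hu 1) (hu 2) = - hu 3"
  "hbracket (hu 1) (hu 3) = hu 1 + hu 2"
  "hbracket (hu 2) (hu 3) = - hu 2"
  by (simp_all add: hbracket_def hu_def axis_def)

lemma bilinear_hbracket: "bilinear hbracket"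
  by (auto simp: bilinear_def hbracket_def vec_eq_iff algebra_simps intro!: linearI)

lemma hbracket_antisym: "hbracket Y X = - hbracket X Y"
  by (simp add: hbracket_def vec_eq_iff algebra_simps)

lemma hbracket_Jacobi:
  "hbracket X (hbracket Y Z) + hbracket Y (hbracket Z X) + hbracket Z (hbracket X Y) = 0"
  by (simp add: hbracket_def hu_def axis_def vec_eq_iff forall_3) (simp add: algebra_simps)

definition hybrid_K :: "real^3^3"
  where "hybrid_K = (\<chi> i j. killing_form hbracket (hu i) (hu j))"

definition hybrid_B :: "real^3^3"
  where "hybrid_B = (1/2) *\<^sub>R hybrid_K"

definition golden_ratio :: real
  where "golden_ratio = (1 + sqrt 5) / 2"

end

theory Submission
  imports Defs
begin

text \<open>Computing traces of products of the \<open>ad\<close> maps shows that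
  \<open>hybrid_B\<close> is block diagonal (\<open>hybrid_B_eq\<close>): \<open>hu 3\<close> is
  Killing-orthogonal to \<open>hu 1\<close> and \<open>hu 2\<close> and gives the factor
  \<open>1 - l\<close>; the 2x2 block has trace -1 and determinant -1, giving
  \<open>l\<^sup>2 + l - 1\<close>. Eigenvalues are roots of the determinant, and the roots of the
  quadratic are the golden ones.\<close>

lemma eigenvalue_iff_det_eq_0:
  fixes A :: "real^'n^'n"
  shows "eigenvalue A l \<longleftrightarrow> det (A - l *\<^sub>R mat 1) = 0"
proof -
  have "(A - l *\<^sub>R mat 1) *v v = A *v v - l *\<^sub>R v" for v
    by (simp add: matrix_vector_mult_diff_rdistrib scaleR_matrix_vector_assoc [symmetric])
  then have "eigenvalue A l \<longleftrightarrow> (\<exists>v. v \<noteq> 0 \<and> (A - l *\<^sub>R mat 1) *v v = 0)"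
    by (simp add: eigenvalue_def)
  also have "\<dots> \<longleftrightarrow> det (A - l *\<^sub>R mat 1) = 0"
    \<comment> \<open>For a square matrix, nonzero determinant, left invertibility and trivial
      kernel coincide.\<close>
    using invertible_det_nz invertible_left_inverse matrix_left_invertible_ker by metis
  finally show ?thesis .
qed

lemma hybrid_B_eq:
  "hybrid_B = vector [vector [-1, 1, 0], vector [1, 0, 0], vector [0, 0, 1]]"
  by (simp add: hybrid_B_def hybrid_K_def killing_form_def ad_def trace_def matrix_def
      hbracket_def hu_def axis_def vec_eq_iff forall_3 sum_3)

lemma det_hybrid_B:
  "det (hybrid_B - l *\<^sub>R mat 1) = (1 - l) * (l\<^sup>2 + l - 1)"
  by (simp add: hybrid_B_eq det_3 mat_def power2_eq_square algebra_simps)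

text \<open>By Vieta: the two roots have sum -1 and product (1 - 5)/4 = -1.\<close>

lemma golden_quadratic_factor:
  fixes l :: real
  shows "l\<^sup>2 + l - 1 = (l - (-1 + sqrt 5) / 2) * (l - (-1 - sqrt 5) / 2)"
  by (simp add: field_simps power2_eq_square)

theorem mainTheorem5:
  "(\<forall>l::real. det (hybrid_B - l *\<^sub>R mat 1) = (1 - l) * (l\<^sup>2 + l - 1))
   \<and> {l. eigenvalue hybrid_B l} = {1, (-1 + sqrt 5) / 2, (-1 - sqrt 5) / 2}
   \<and> (-1 + sqrt 5) / 2 = 1 / golden_ratio
   \<and> (-1 - sqrt 5) / 2 = - golden_ratio"
proof (intro conjI allI)
  show "det (hybrid_B - l *\<^sub>R mat 1) = (1 - l) * (l\<^sup>2 + l - 1)" for l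
    by (rule det_hybrid_B)
  show "{l. eigenvalue hybrid_B l} = {1, (-1 + sqrt 5) / 2, (-1 - sqrt 5) / 2}"
    \<comment> \<open>The determinant is now a product of three linear factors, one per
      eigenvalue.\<close>
    unfolding eigenvalue_iff_det_eq_0 det_hybrid_B golden_quadratic_factor mult_eq_0_iff
    by auto
  \<comment> \<open>Allows clearing the denominator of \<open>1 / golden_ratio\<close>; what remains
    is (sqrt 5 - 1)(sqrt 5 + 1) = 4.\<close>
  have "1 + sqrt 5 \<noteq> 0"
    using real_sqrt_ge_zero [of 5] by linarith
  then show "(-1 + sqrt 5) / 2 = 1 / golden_ratio"
    by (simp add: golden_ratio_def field_simps)
  show "(-1 - sqrt 5) / 2 = - golden_ratio"
    by (simp add: golden_ratio_def field_simps)
qed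

end
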